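(* Let $R$ be an SSP ring. Then the following are equivalent: (1) $R$ is IC; (2) for any regular elements $a,b\in R$, $Ra+Rb=R$ implies that there exists an idempotent $e\in R$ such that $a+eb\in U(R)$ and $aR\oplus eR=R$; (3) every regular element in $R$ is special clean.
   Context: All rings are associative with identity (not necessarily commutative); $U(R)$ denotes the set of units of $R$. An element $a\in R$ is (von Neumann) regular if there exists $x\in R$ with $a=axa$; it is unit-regular if there exists a unit $x\in R$ with $a=axa$. A ring $R$ is IC (has internal cancellation) if every regular element of $R$ is unit-regular. A ring $R$ is SSP (has the summand sum property) if the sum of any two direct summands of the right module $R_R$ is a direct summand of $R_R$. An element $a\in R$ is special clean if there exist an idempotent $e\in R$ and a unit $u\in R$ such that $a=e+u$ and $aR\cap eR=0$. The notation $aR\oplus eR=R$ means that $R$ is the internal direct sum of its right ideals $aR$ and $eR$. *)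

theory Defs
  imports "HOL-Algebra.Ideal"
begin

text \<open>
  The locale \<^locale>\<open>ring\<close> is that of associative, not necessarily commutative rings with identity
  (the zero ring included). In a ring \<open>R\<close> the principal right ideal \<open>aR\<close> is written
  \<open>a <#\<^bsub>R\<^esub> carrier R\<close> and the principal left ideal \<open>Ra\<close> is written
  \<open>carrier R #>\<^bsub>R\<^esub> a\<close>.
\<close>

definition vn_regular :: "('a, 'm) ring_scheme \<Rightarrow> 'a \<Rightarrow> bool"
  where "vn_regular R a \<longleftrightarrow>
    a \<in> carrier R \<and> (\<exists>x\<in>carrier R. a = a \<otimes>\<^bsub>R\<^esub> x \<otimes>\<^bsub>R\<^esub> a)"

definition unit_regular :: "('a, 'm) ring_scheme \<Rightarrow> 'a \<Rightarrow> bool"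
  where "unit_regular R a \<longleftrightarrow>
    a \<in> carrier R \<and> (\<exists>x\<in>Units R. a = a \<otimes>\<^bsub>R\<^esub> x \<otimes>\<^bsub>R\<^esub> a)"

definition IC :: "('a, 'm) ring_scheme \<Rightarrow> bool"
  where "IC R \<longleftrightarrow> (\<forall>a\<in>carrier R. vn_regular R a \<longrightarrow> unit_regular R a)"

definition idempotent_elem :: "('a, 'm) ring_scheme \<Rightarrow> 'a \<Rightarrow> bool"
  where "idempotent_elem R e \<longleftrightarrow> e \<in> carrier R \<and> e \<otimes>\<^bsub>R\<^esub> e = e"

text \<open>
  The submodules of the right module \<open>R\<^sub>R\<close> are the right ideals of \<open>R\<close>; the library's
  \<^locale>\<open>ideal\<close> is two-sided and its modules are over commutative rings.
\<close>

definition right_ideal :: "('a, 'm) ring_scheme \<Rightarrow> 'a set \<Rightarrow> bool"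
  where "right_ideal R I \<longleftrightarrow>
    additive_subgroup I R \<and> (\<forall>a\<in>I. \<forall>r\<in>carrier R. a \<otimes>\<^bsub>R\<^esub> r \<in> I)"

definition internal_direct_sum :: "('a, 'm) ring_scheme \<Rightarrow> 'a set \<Rightarrow> 'a set \<Rightarrow> bool"
  where "internal_direct_sum R I J \<longleftrightarrow>
    right_ideal R I \<and> right_ideal R J \<and> I <+>\<^bsub>R\<^esub> J = carrier R \<and> I \<inter> J = {\<zero>\<^bsub>R\<^esub>}"

definition direct_summand :: "('a, 'm) ring_scheme \<Rightarrow> 'a set \<Rightarrow> bool"
  where "direct_summand R I \<longleftrightarrow> (\<exists>J. internal_direct_sum R I J)"

definition SSP :: "('a, 'm) ring_scheme \<Rightarrow> bool"
  where "SSP R \<longleftrightarrow>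
    (\<forall>I J. direct_summand R I \<longrightarrow> direct_summand R J \<longrightarrow> direct_summand R (I <+>\<^bsub>R\<^esub> J))"

definition special_clean :: "('a, 'm) ring_scheme \<Rightarrow> 'a \<Rightarrow> bool"
  where "special_clean R a \<longleftrightarrow>
    a \<in> carrier R \<and>
    (\<exists>e u. idempotent_elem R e \<and> u \<in> Units R \<and> a = e \<oplus>\<^bsub>R\<^esub> u \<and>
       (a <#\<^bsub>R\<^esub> carrier R) \<inter> (e <#\<^bsub>R\<^esub> carrier R) = {\<zero>\<^bsub>R\<^esub>})"

end

theory Submission
  imports Defs
begin

text \<open>
  The way back to internal cancellation is a short calculation.  If \<open>a = e + u\<close> is a
  special clean decomposition, then \<open>a u\<^sup>-\<^sup>1 a - a = a u\<^sup>-\<^sup>1 e = e u\<^sup>-\<^sup>1 e + e\<close> lies in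
  \<open>aR \<inter> eR = 0\<close>, so \<open>a\<close> is unit-regular; and the choice \<open>b = -1\<close> turns the stable range
  condition into special cleanness.

  For the remaining implication, write \<open>a = a u a\<close> with \<open>u\<close> a unit.  Multiplying by \<open>u\<close> on the left
  replaces \<open>a\<close> by the idempotent \<open>f = u a\<close> and \<open>b\<close> by \<open>u b\<close>, so that \<open>r f + s b = 1\<close> for some
  \<open>r, s\<close>.  Put \<open>p = 1 - f\<close> and look for an idempotent with \<open>eR = pR\<close>, that is, \<open>e = p + z\<close> with
  \<open>z \<in> pRf\<close>.  With respect to \<open>R = fR \<oplus> pR\<close> the element \<open>f + e b\<close> is then lower triangular with
  diagonal entries \<open>f\<close> and \<open>c + z b p\<close>, where \<open>c = p b p\<close>, and it remains to choose \<open>z\<close> such that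
  the second entry is a unit of the corner \<open>pRp\<close>.  This is where both hypotheses enter.

  \<^item> The summand sum property makes products of regular elements regular (lemma
    \<open>vn_regular_mult\<close>), hence \<open>c\<close> is regular.
  \<^item> Internal cancellation makes \<open>c\<close> unit-regular even inside the corner: the lemma
    \<open>IC_unit_of_inner_inverse\<close>, applied to \<open>c + f\<close>, gives a unit \<open>v\<close> of \<open>R\<close> that respects the
    decomposition and satisfies \<open>c = v q\<close> for an idempotent \<open>q \<in> pRp\<close>.

  Since \<open>p = p s b p\<close> and \<open>c (p - q) = 0\<close>, the element \<open>z = v (p - q) s f\<close> makes \<open>c + z b p\<close> equal
  to \<open>v (p + N)\<close> with \<open>N\<^sup>2 = 0\<close>.
\<close>

section \<open>Idempotents and units\<close>

context ring
begin

lemma mult_absorb: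
  assumes "x \<otimes> y = z" "x \<in> carrier R" "y \<in> carrier R" "t \<in> carrier R"
  shows "x \<otimes> (y \<otimes> t) = z \<otimes> t"
  using assms by (simp add: m_assoc[symmetric])

lemma idempotent_complement:
  assumes "f \<in> carrier R" "f \<otimes> f = f"
  obtains p where "p \<in> carrier R" "p \<oplus> f = \<one>" "p \<otimes> f = \<zero>" "f \<otimes> p = \<zero>" "p \<otimes> p = p"
proof
  let ?p = "\<one> \<ominus> f"
  show p: "?p \<in> carrier R" using assms by simp
  show sum: "?p \<oplus> f = \<one>" using assms by algebra
  show "f \<otimes> ?p = \<zero>" using assms by (simp add: minus_eq r_distr r_minus r_neg)
  show pf: "?p \<otimes> f = \<zero>" using assms by (simp add: minus_eq l_distr l_minus r_neg)
  have "?p \<otimes> (?p \<oplus> f) = ?p \<otimes> ?p"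
    using p assms pf by (simp only: r_distr r_zero m_closed)
  then show "?p \<otimes> ?p = ?p" using p by (simp only: sum r_one)
qed

lemma unit_one_plus_square_zero:
  assumes N: "N \<in> carrier R" and "N \<otimes> N = \<zero>"
  shows "\<one> \<oplus> N \<in> Units R"
proof -
  have "(\<one> \<oplus> N) \<otimes> (\<one> \<ominus> N) = \<one>" "(\<one> \<ominus> N) \<otimes> (\<one> \<oplus> N) = \<one>"
    using assms by (simp_all add: minus_eq l_distr r_distr l_minus r_minus a_assoc r_neg l_neg)
  then show ?thesis using N by (auto simp: Units_def)
qed

section \<open>Right ideals and direct sum decompositions\<close>

lemma mem_principal_right: "x \<in> a <# carrier R \<longleftrightarrow> (\<exists>r\<in>carrier R. x = a \<otimes> r)"
  by (auto simp: l_coset_def)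

lemma mem_principal_left: "x \<in> carrier R #> a \<longleftrightarrow> (\<exists>r\<in>carrier R. x = r \<otimes> a)"
  by (auto simp: r_coset_def)

lemma mem_set_add: "x \<in> I <+> J \<longleftrightarrow> (\<exists>i\<in>I. \<exists>j\<in>J. x = i \<oplus> j)"
  by (auto simp: set_add_defs)

lemma mem_principal_right_add:
  "r \<in> carrier R \<Longrightarrow> s \<in> carrier R \<Longrightarrow> a \<otimes> r \<oplus> b \<otimes> s \<in> (a <# carrier R) <+> (b <# carrier R)"
  unfolding mem_set_add Bex_def mem_principal_right by blast

lemma mem_principal_left_add:
  "r \<in> carrier R \<Longrightarrow> s \<in> carrier R \<Longrightarrow> r \<otimes> a \<oplus> s \<otimes> b \<in> (carrier R #> a) <+> (carrier R #> b)"
  unfolding mem_set_add Bex_def mem_principal_left by blast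

lemma vn_regularI: "\<lbrakk>a \<in> carrier R; x \<in> carrier R; a \<otimes> x \<otimes> a = a\<rbrakk> \<Longrightarrow> vn_regular R a"
  unfolding vn_regular_def by metis

lemma right_ideal_principal:
  assumes a: "a \<in> carrier R"
  shows "right_ideal R (a <# carrier R)"
proof -
  have "subgroup (a <# carrier R) (add_monoid R)"
  proof (rule add.subgroupI)
    show "a <# carrier R \<subseteq> carrier R" using a by (auto simp: mem_principal_right)
    show "a <# carrier R \<noteq> {}" using mem_principal_right by blast
  next
    fix x assume "x \<in> a <# carrier R"
    then obtain r where "r \<in> carrier R" "x = a \<otimes> r" by (auto simp: mem_principal_right)
    then have "\<ominus> r \<in> carrier R" "\<ominus> x = a \<otimes> (\<ominus> r)" using a by (simp_all add: r_minus)
    then show "\<ominus> x \<in> a <# carrier R" unfolding mem_principal_right by blast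
  next
    fix x y assume "x \<in> a <# carrier R" "y \<in> a <# carrier R"
    then obtain r s where "r \<in> carrier R" "x = a \<otimes> r" "s \<in> carrier R" "y = a \<otimes> s"
      by (auto simp: mem_principal_right)
    then have "r \<oplus> s \<in> carrier R" "x \<oplus> y = a \<otimes> (r \<oplus> s)" using a by (simp_all add: r_distr)
    then show "x \<oplus> y \<in> a <# carrier R" unfolding mem_principal_right by blast
  qed
  moreover have "\<forall>x\<in>a <# carrier R. \<forall>r\<in>carrier R. x \<otimes> r \<in> a <# carrier R"
    using a by (fastforce simp: mem_principal_right m_assoc)
  ultimately show ?thesis by (simp add: right_ideal_def additive_subgroup.intro)
qed

lemma principal_internal_direct_sumI:
  assumes a: "a \<in> carrier R" and e: "e \<in> carrier R"
    and x: "x \<in> carrier R" and y: "y \<in> carrier R"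
    and one: "a \<otimes> x \<oplus> e \<otimes> y = \<one>"
    and disjoint: "\<And>r s. \<lbrakk>r \<in> carrier R; s \<in> carrier R; a \<otimes> r = e \<otimes> s\<rbrakk> \<Longrightarrow> a \<otimes> r = \<zero>"
  shows "internal_direct_sum R (a <# carrier R) (e <# carrier R)"
  unfolding internal_direct_sum_def
proof (intro conjI right_ideal_principal a e)
  show "(a <# carrier R) <+> (e <# carrier R) = carrier R"
  proof
    show "(a <# carrier R) <+> (e <# carrier R) \<subseteq> carrier R"
      using a e by (auto simp: mem_set_add mem_principal_right)
  next
    show "carrier R \<subseteq> (a <# carrier R) <+> (e <# carrier R)"
    proof
      fix t assume t: "t \<in> carrier R"
      have "t = (a \<otimes> x \<oplus> e \<otimes> y) \<otimes> t" using one t by simp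
      also have "\<dots> = a \<otimes> (x \<otimes> t) \<oplus> e \<otimes> (y \<otimes> t)"
        using a e x y t by (simp add: l_distr m_assoc)
      finally show "t \<in> (a <# carrier R) <+> (e <# carrier R)"
        using x y t by (metis m_closed mem_principal_right_add)
    qed
  qed
  have "\<zero> \<in> a <# carrier R" "\<zero> \<in> e <# carrier R"
    unfolding mem_principal_right using a e r_null zero_closed by metis+
  moreover have "t = \<zero>" if "t \<in> a <# carrier R" "t \<in> e <# carrier R" for t
    using that disjoint unfolding mem_principal_right by metis
  ultimately show "(a <# carrier R) \<inter> (e <# carrier R) = {\<zero>}" by blast
qed

lemma direct_summand_idempotent:
  assumes e: "e \<in> carrier R" "e \<otimes> e = e"
  shows "direct_summand R (e <# carrier R)"
proof -
  obtain p where p: "p \<in> carrier R" "p \<oplus> e = \<one>" "e \<otimes> p = \<zero>"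
    using idempotent_complement[OF e] by metis
  have "internal_direct_sum R (e <# carrier R) (p <# carrier R)"
  proof (rule principal_internal_direct_sumI[OF _ _ one_closed one_closed])
    show "e \<otimes> \<one> \<oplus> p \<otimes> \<one> = \<one>" using p e by (simp add: a_comm)
  next
    fix r s assume rs: "r \<in> carrier R" "s \<in> carrier R" "e \<otimes> r = p \<otimes> s"
    have "e \<otimes> r = e \<otimes> (e \<otimes> r)" using e(1) rs(1) by (simp add: mult_absorb[OF e(2)])
    also have "\<dots> = \<zero>"
      unfolding rs(3) using p(1) e(1) rs(2) by (simp add: mult_absorb[OF p(3)])
    finally show "e \<otimes> r = \<zero>" .
  qed (use e p in auto)
  then show ?thesis by (auto simp: direct_summand_def)
qed

text \<open>
  The component in \<open>I\<close> of the identity acts on \<open>I\<close> as a left identity; it is the idempotent that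
  generates \<open>I\<close>.
\<close>

lemma direct_summand_left_identity:
  assumes "direct_summand R I"
  obtains k where "k \<in> I" "k \<in> carrier R" "\<And>x. x \<in> I \<Longrightarrow> k \<otimes> x = x"
proof -
  obtain J where J: "right_ideal R I" "right_ideal R J" "I <+> J = carrier R" "I \<inter> J = {\<zero>}"
    using assms by (auto simp: direct_summand_def internal_direct_sum_def)
  interpret I: additive_subgroup I R using J by (simp add: right_ideal_def)
  interpret J: additive_subgroup J R using J by (simp add: right_ideal_def)
  obtain k l where kl: "k \<in> I" "l \<in> J" "\<one> = k \<oplus> l" using J(3) one_closed mem_set_add by metis
  show ?thesis
  proof
    fix x assume x: "x \<in> I"
    then have cl: "x \<in> carrier R" "k \<in> carrier R" "l \<in> carrier R" using kl by auto
    have eq: "x = k \<otimes> x \<oplus> l \<otimes> x" using kl(3) cl l_distr l_one by metis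
    then have "l \<otimes> x = x \<oplus> \<ominus> (k \<otimes> x)"
      using cl by (metis a_comm a_inv_closed add.inv_solve_right m_closed)
    moreover have "x \<oplus> \<ominus> (k \<otimes> x) \<in> I"
      using J(1) kl(1) x cl by (auto simp: right_ideal_def)
    moreover have "l \<otimes> x \<in> J" using J(2) kl(2) cl by (auto simp: right_ideal_def)
    ultimately have "l \<otimes> x = \<zero>" using J(4) by auto
    then show "k \<otimes> x = x" using eq cl by simp
  qed (use kl in auto)
qed

section \<open>Products of regular elements under the summand sum property\<close>

text \<open>
  For idempotents \<open>g\<close> and \<open>h\<close> the right ideal \<open>(1 - g)R + hR\<close> equals \<open>(1 - g)R \<oplus> ghR\<close>.  If it is
  a summand, then so is \<open>ghR\<close>, which means that \<open>gh\<close> is regular.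
\<close>

lemma SSP_idempotent_mult_regular:
  assumes ssp: "SSP R" and g: "g \<in> carrier R" "g \<otimes> g = g" and h: "h \<in> carrier R" "h \<otimes> h = h"
  shows "vn_regular R (g \<otimes> h)"
proof -
  obtain p where p: "p \<in> carrier R" "p \<oplus> g = \<one>" "g \<otimes> p = \<zero>" "p \<otimes> p = p"
    using idempotent_complement[OF g] by metis
  have "direct_summand R ((p <# carrier R) <+> (h <# carrier R))"
    using ssp direct_summand_idempotent p h by (simp add: SSP_def)
  then obtain k :: 'a where k: "k \<in> (p <# carrier R) <+> (h <# carrier R)" "k \<in> carrier R"
    and kx: "\<And>x. x \<in> (p <# carrier R) <+> (h <# carrier R) \<Longrightarrow> k \<otimes> x = x"
    using direct_summand_left_identity by blast
  obtain r s where rs: "r \<in> carrier R" "s \<in> carrier R" "k = p \<otimes> r \<oplus> h \<otimes> s"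
    using k(1) unfolding mem_set_add mem_principal_right Bex_def by blast
  have gk: "g \<otimes> k = g \<otimes> h \<otimes> s"
    using rs g(1) h(1) p(1) by (simp add: r_distr mult_absorb[OF p(3)] m_assoc)
  have "h = p \<otimes> h \<oplus> g \<otimes> h" using p(1,2) g(1) h(1) by (metis l_distr l_one)
  then have "g \<otimes> h = p \<otimes> (\<ominus> h) \<oplus> h \<otimes> \<one>"
    using p(1) g(1) h(1) by (simp add: r_minus) (metis a_assoc a_inv_closed l_neg l_zero m_closed)
  then have kgh: "k \<otimes> (g \<otimes> h) = g \<otimes> h"
    using h(1) by (metis kx a_inv_closed mem_principal_right_add one_closed)
  have "g \<otimes> h \<otimes> s \<otimes> (g \<otimes> h) = g \<otimes> (k \<otimes> (g \<otimes> h))"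
    unfolding gk[symmetric] using g(1) h(1) k(2) by (simp add: m_assoc)
  also have "\<dots> = g \<otimes> h" unfolding kgh using g h by (simp add: mult_absorb)
  finally show ?thesis using g h rs vn_regularI by simp
qed

text \<open>
  If \<open>x\<close> and \<open>y\<close> are inner inverses of \<open>a\<close> and \<open>b\<close>, then \<open>ab = a (xa)(by) b\<close>; an inner inverse \<open>z\<close> of
  the product of the idempotents \<open>xa\<close> and \<open>by\<close> yields the inner inverse \<open>yzx\<close> of \<open>ab\<close>.
\<close>

lemma vn_regular_mult:
  assumes ssp: "SSP R" and a: "vn_regular R a" and b: "vn_regular R b"
  shows "vn_regular R (a \<otimes> b)"
proof -
  obtain x where x: "a \<in> carrier R" "x \<in> carrier R" "a \<otimes> x \<otimes> a = a"
    using a by (auto simp: vn_regular_def)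
  obtain y where y: "b \<in> carrier R" "y \<in> carrier R" "b \<otimes> y \<otimes> b = b"
    using b by (auto simp: vn_regular_def)
  define g h where "g = x \<otimes> a" and "h = b \<otimes> y"
  have gh: "g \<in> carrier R" "h \<in> carrier R" using x y by (auto simp: g_def h_def)
  have ag: "a \<otimes> g = a" and hb: "h \<otimes> b = b" using x y by (simp_all add: g_def h_def m_assoc)
  have "g \<otimes> g = g" using x ag by (simp add: g_def m_assoc)
  moreover have "h \<otimes> h = h" using y hb gh by (simp add: h_def m_assoc[symmetric])
  ultimately have "vn_regular R (g \<otimes> h)" using SSP_idempotent_mult_regular ssp gh by blast
  then obtain z where z: "z \<in> carrier R" "g \<otimes> h \<otimes> z \<otimes> (g \<otimes> h) = g \<otimes> h"
    by (auto simp: vn_regular_def)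
  have "a \<otimes> b \<otimes> (y \<otimes> z \<otimes> x) \<otimes> (a \<otimes> b) = a \<otimes> (h \<otimes> z \<otimes> g) \<otimes> b"
    using x y z gh by (simp add: g_def h_def m_assoc)
  also have "\<dots> = a \<otimes> g \<otimes> (h \<otimes> z \<otimes> g) \<otimes> (h \<otimes> b)" unfolding ag hb ..
  also have "\<dots> = a \<otimes> (g \<otimes> h \<otimes> z \<otimes> (g \<otimes> h)) \<otimes> b"
    using x(1) y(1) z(1) gh by (simp add: m_assoc)
  also have "\<dots> = (a \<otimes> g) \<otimes> (h \<otimes> b)"
    unfolding z(2) using x(1) y(1) gh by (simp add: m_assoc)
  also have "\<dots> = a \<otimes> b" unfolding ag hb ..
  finally show ?thesis using x(1,2) y(1,2) z(1) vn_regularI[of "a \<otimes> b" "y \<otimes> z \<otimes> x"] by simp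
qed

section \<open>Units adapted to a given inner inverse\<close>

text \<open>
  An inner inverse \<open>y\<close> of \<open>a\<close> splits \<open>R\<close> as \<open>yaR \<oplus> (1 - ya)R\<close> on the source and as
  \<open>ayR \<oplus> (1 - ay)R\<close> on the target, and \<open>a\<close> maps \<open>yaR\<close> isomorphically onto \<open>ayR\<close>.  For \<open>a = a w a\<close>
  with \<open>w\<close> a unit, \<open>w\<^sup>-\<^sup>1\<close> carries \<open>(1 - ya)R\<close>, the right annihilator of \<open>a\<close>, onto the complement
  \<open>(1 - aw)R\<close> of \<open>aR\<close>, and projecting along \<open>aR\<close> carries this onto \<open>(1 - ay)R\<close>.  Hence
  \<open>(1 - ay) w\<^sup>-\<^sup>1 (1 - ya)\<close> extends \<open>a\<close> to a unit that respects both splittings.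
\<close>

lemma IC_unit_of_inner_inverse:
  assumes ic: "IC R" and a: "a \<in> carrier R" and y: "y \<in> carrier R" and aya: "a \<otimes> y \<otimes> a = a"
  obtains v where "v \<in> Units R" "v \<otimes> (y \<otimes> a) = a" "a \<otimes> y \<otimes> v = a"
proof -
  have "unit_regular R a" using ic a vn_regularI[OF a y aya] by (simp add: IC_def)
  then obtain w where w: "w \<in> Units R" "a \<otimes> w \<otimes> a = a" by (auto simp: unit_regular_def)
  define w' where "w' = inv w"
  have wc: "w \<in> carrier R" "w' \<in> carrier R" "w \<otimes> w' = \<one>" "w' \<otimes> w = \<one>"
    using w by (simp_all add: w'_def Units_closed)
  have aya': "a \<otimes> (y \<otimes> a) = a" using a y aya by (simp add: m_assoc)
  have idem: "(y \<otimes> a) \<otimes> (y \<otimes> a) = y \<otimes> a" "(a \<otimes> y) \<otimes> (a \<otimes> y) = a \<otimes> y"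
    "(a \<otimes> w) \<otimes> (a \<otimes> w) = a \<otimes> w"
    using a y wc(1) aya w(2) aya' by (simp_all add: m_assoc) (simp_all add: m_assoc[symmetric])
  obtain i where i: "i \<in> carrier R" "i \<oplus> y \<otimes> a = \<one>" "i \<otimes> (y \<otimes> a) = \<zero>" "y \<otimes> a \<otimes> i = \<zero>"
    using idempotent_complement[OF _ idem(1)] a y by (metis m_closed)
  obtain j where j: "j \<in> carrier R" "j \<oplus> a \<otimes> y = \<one>" "j \<otimes> (a \<otimes> y) = \<zero>" "a \<otimes> y \<otimes> j = \<zero>"
    "j \<otimes> j = j"
    using idempotent_complement[OF _ idem(2)] a y by (metis m_closed)
  obtain k where k: "k \<in> carrier R" "k \<oplus> a \<otimes> w = \<one>" "k \<otimes> (a \<otimes> w) = \<zero>" "a \<otimes> w \<otimes> k = \<zero>"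
    using idempotent_complement[OF _ idem(3)] a wc by (metis m_closed)
  have ai: "a \<otimes> i = \<zero>"
  proof -
    have "a \<otimes> i = a \<otimes> (y \<otimes> a \<otimes> i)" using aya' a y i(1) by (metis m_assoc m_closed)
    then show ?thesis using i(4) a by simp
  qed
  have ja: "j \<otimes> a = \<zero>"
  proof -
    have "j \<otimes> a = j \<otimes> (a \<otimes> y) \<otimes> a" using aya a y j(1) by (simp add: m_assoc)
    then show ?thesis using j(3) a by simp
  qed
  have ka: "k \<otimes> a = \<zero>"
  proof -
    have "k \<otimes> a = k \<otimes> (a \<otimes> w) \<otimes> a" using w(2) a wc k(1) by (simp add: m_assoc)
    then show ?thesis using k(3) a by simp
  qed
  have jk: "j \<otimes> k = j"
  proof -
    have "j \<otimes> (k \<oplus> a \<otimes> w) = j \<otimes> k \<oplus> (j \<otimes> a) \<otimes> w"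
      using a wc(1) j(1) k(1) by (simp add: r_distr m_assoc)
    then show ?thesis using k(1,2) j(1) ja wc by simp
  qed
  have kj: "k \<otimes> j = k"
  proof -
    have "k \<otimes> (j \<oplus> a \<otimes> y) = k \<otimes> j \<oplus> (k \<otimes> a) \<otimes> y"
      using a y j(1) k(1) by (simp add: r_distr m_assoc)
    then show ?thesis using j(1,2) k(1) ka y by simp
  qed
  have iwk: "i \<otimes> (w \<otimes> k) = w \<otimes> k"
  proof -
    have "(i \<oplus> y \<otimes> a) \<otimes> (w \<otimes> k) = i \<otimes> (w \<otimes> k) \<oplus> y \<otimes> (a \<otimes> w \<otimes> k)"
      using a y wc(1) i(1) k(1) by (simp add: l_distr m_assoc)
    then show ?thesis using i(1,2) k(1,4) wc(1) y by simp
  qed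
  have kwi: "k \<otimes> (w' \<otimes> i) = w' \<otimes> i"
  proof -
    have "(k \<oplus> a \<otimes> w) \<otimes> (w' \<otimes> i) = k \<otimes> (w' \<otimes> i) \<oplus> a \<otimes> ((w \<otimes> w') \<otimes> i)"
      using a wc(1,2) i(1) k(1) by (simp add: l_distr m_assoc)
    then show ?thesis using i(1) k(1,2) wc ai by simp
  qed
  have iya: "i \<otimes> (y \<otimes> (a \<otimes> t)) = \<zero>" and ayj: "a \<otimes> (y \<otimes> (j \<otimes> t)) = \<zero>" if "t \<in> carrier R" for t
    using i(1,3) j(1,4) a y that by (simp_all add: m_assoc[symmetric])
  define v v' where "v = a \<oplus> j \<otimes> (w' \<otimes> i)" and "v' = y \<otimes> (a \<otimes> y) \<oplus> w \<otimes> (k \<otimes> j)"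
  have vc: "v \<in> carrier R" "v' \<in> carrier R"
    using a y wc i j k by (auto simp: v_def v'_def)
  show ?thesis
  proof
    have "v \<otimes> v' = a \<otimes> (y \<otimes> (a \<otimes> y)) \<oplus> (a \<otimes> w \<otimes> k) \<otimes> j
        \<oplus> (j \<otimes> (w' \<otimes> (i \<otimes> (y \<otimes> (a \<otimes> y)))) \<oplus> j \<otimes> (w' \<otimes> (i \<otimes> (w \<otimes> k) \<otimes> j)))"
      using a y wc(1,2) i(1) j(1) k(1) by (simp add: v_def v'_def l_distr r_distr m_assoc a_ac)
    also have "\<dots> = a \<otimes> y \<oplus> j \<otimes> ((w' \<otimes> w) \<otimes> (k \<otimes> j))"
      using a y wc(1,2) i(1) j(1) k(1) idem(2) k(4)
      by (simp add: iwk iya) (simp add: m_assoc)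
    also have "\<dots> = \<one>"
      using a y wc(4) j k(1) kj jk by (simp add: a_comm)
    finally have 1: "v \<otimes> v' = \<one>" .
    have "v' \<otimes> v = y \<otimes> (a \<otimes> y \<otimes> a) \<oplus> y \<otimes> (a \<otimes> (y \<otimes> (j \<otimes> (w' \<otimes> i))))
        \<oplus> (w \<otimes> (k \<otimes> (j \<otimes> a)) \<oplus> w \<otimes> (k \<otimes> (j \<otimes> j) \<otimes> (w' \<otimes> i)))"
      using a y wc(1,2) i(1) j(1) k(1) by (simp add: v_def v'_def l_distr r_distr m_assoc a_ac)
    also have "\<dots> = y \<otimes> a \<oplus> (w \<otimes> w') \<otimes> i"
      using a y wc(1,2) i(1) j(1,5) k(1)
      by (simp add: aya ayj ja kj kwi m_assoc)
    also have "\<dots> = \<one>" using wc(3) i a y by (simp add: a_comm)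
    finally have 2: "v' \<otimes> v = \<one>" .
    show "v \<in> Units R" using 1 2 vc by (auto simp: Units_def)
    show "v \<otimes> (y \<otimes> a) = a"
      using a y wc(1,2) i(1,3) j(1) by (simp add: v_def l_distr aya' m_assoc)
    show "a \<otimes> y \<otimes> v = a"
      using a y wc(1,2) i(1) j(1) by (simp add: v_def r_distr aya aya' ayj m_assoc)
  qed
qed

section \<open>The stable range condition\<close>

text \<open>
  Here \<open>q = y c\<close> for an inner inverse \<open>y \<in> pRp\<close> of \<open>c = p b p\<close>, and \<open>d = p - q\<close> projects onto the
  part of \<open>pR\<close> annihilated by \<open>c\<close>.  On \<open>qR\<close> the map \<open>c\<close> already agrees with the unit \<open>v\<close>; on \<open>dR\<close> the
  equation \<open>r f + s b = 1\<close> makes \<open>d s\<close> a left inverse of \<open>f b\<close>, which is why the correction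
  \<open>z = v d s f\<close> completes \<open>c\<close> to a unit of \<open>pRp\<close>.  The idempotent \<open>p\<close> and the equations relating it
  to \<open>e\<close> and \<open>f\<close> say that \<open>eR = pR\<close> is a complement of \<open>fR\<close>.
\<close>

lemma IC_SSP_idempotent_completion:
  assumes ic: "IC R" and ssp: "SSP R"
    and f: "f \<in> carrier R" "f \<otimes> f = f" and b: "vn_regular R b"
    and r: "r \<in> carrier R" and s: "s \<in> carrier R" and rfsb: "r \<otimes> f \<oplus> s \<otimes> b = \<one>"
  obtains e p where "e \<in> carrier R" "e \<otimes> e = e" "p \<in> carrier R" "p \<oplus> f = \<one>"
    "e \<otimes> p = p" "f \<otimes> e = \<zero>" "f \<oplus> e \<otimes> b \<in> Units R"
proof -
  obtain p where p: "p \<in> carrier R" "p \<oplus> f = \<one>" "p \<otimes> f = \<zero>" "f \<otimes> p = \<zero>" "p \<otimes> p = p"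
    using idempotent_complement[OF f] by metis
  have bc: "b \<in> carrier R" using b by (simp add: vn_regular_def)
  note cl = f(1) p(1) bc r s
  have preg: "vn_regular R p" using vn_regularI[of p p] p by simp
  define c where "c = p \<otimes> (b \<otimes> p)"
  have cc: "c \<in> carrier R" using cl by (simp add: c_def)
  have "vn_regular R c" unfolding c_def using vn_regular_mult[OF ssp] preg b by blast
  then obtain x where x: "x \<in> carrier R" "c \<otimes> x \<otimes> c = c" by (auto simp: vn_regular_def)
  have pc: "p \<otimes> c = c" "c \<otimes> p = c" "f \<otimes> c = \<zero>" "c \<otimes> f = \<zero>"
    using cl p by (simp_all add: c_def m_assoc mult_absorb[OF p(4)] mult_absorb[OF p(5)])
  define y where "y = p \<otimes> (x \<otimes> p)"
  have yc: "y \<in> carrier R" using cl x by (simp add: y_def)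
  have fy: "f \<otimes> y = \<zero>" "y \<otimes> f = \<zero>" "p \<otimes> y = y"
    using cl x(1) p
    by (simp_all add: y_def m_assoc mult_absorb[OF p(4)] mult_absorb[OF p(5)])
  have cyc: "c \<otimes> (y \<otimes> c) = c"
  proof -
    have "c \<otimes> (y \<otimes> c) = (c \<otimes> p) \<otimes> x \<otimes> (p \<otimes> c)" using cl x(1) cc by (simp add: y_def m_assoc)
    then show ?thesis using pc x by simp
  qed
  \<comment> \<open>Adding \<open>f\<close> makes the unit below act as the identity on \<open>fR\<close>, so that it restricts to \<open>pR\<close>.\<close>
  have "(c \<oplus> f) \<otimes> (y \<oplus> f) = c \<otimes> y \<oplus> f" "(y \<oplus> f) \<otimes> (c \<oplus> f) = y \<otimes> c \<oplus> f"
    using cc yc f pc(3,4) fy(1,2) by (simp_all add: l_distr r_distr)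
  moreover have "(c \<otimes> y \<oplus> f) \<otimes> (c \<oplus> f) = c \<oplus> f"
    using cc yc f pc(3,4) fy(1,2) cyc by (simp add: l_distr r_distr m_assoc)
  ultimately obtain v where v: "v \<in> Units R" "v \<otimes> (y \<otimes> c \<oplus> f) = c \<oplus> f"
    "(c \<otimes> y \<oplus> f) \<otimes> v = c \<oplus> f"
    using IC_unit_of_inner_inverse[OF ic, of "c \<oplus> f" "y \<oplus> f"] cc yc f by (metis a_closed)
  have vc: "v \<in> carrier R" using v by (simp add: Units_closed)
  define q where "q = y \<otimes> c"
  have qc: "q \<in> carrier R" using cc yc by (simp add: q_def)
  have q: "q \<otimes> q = q" "p \<otimes> q = q" "q \<otimes> f = \<zero>" "f \<otimes> q = \<zero>" "q \<otimes> p = q" "c \<otimes> q = c"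
    using cc yc cl pc fy cyc
    by (simp_all add: q_def m_assoc mult_absorb[OF fy(1)] mult_absorb[OF fy(3)])
  have vf: "v \<otimes> f = f"
  proof -
    have "v \<otimes> (q \<oplus> f) \<otimes> f = v \<otimes> f"
      using vc qc f q by (simp add: m_assoc l_distr)
    then show ?thesis using v(2) cc f pc by (simp add: q_def l_distr)
  qed
  have fv: "f \<otimes> v = f"
  proof -
    have "f \<otimes> ((c \<otimes> y \<oplus> f) \<otimes> v) = f \<otimes> v"
      using vc cc yc f by (simp add: r_distr m_assoc[symmetric] pc)
    then show ?thesis using v(3) cc f pc by (simp add: r_distr)
  qed
  have vq: "v \<otimes> q = c"
    using v(2) vc qc cc f vf by (simp add: q_def[symmetric] r_distr)
  define d where "d = p \<ominus> q"
  have dc: "d \<in> carrier R" using cl qc by (simp add: d_def)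
  have dq: "d \<oplus> q = p" using cl(2) qc unfolding d_def by algebra
  have d: "d \<otimes> p = d" "p \<otimes> d = d" "f \<otimes> d = \<zero>" "q \<otimes> d = \<zero>" "c \<otimes> d = \<zero>" "d \<otimes> f = \<zero>"
    using cl(1,2) cc qc p q pc
    by (simp_all add: d_def minus_eq l_distr r_distr l_minus r_minus r_neg)
  define n where "n = d \<otimes> (s \<otimes> (f \<otimes> b))"
  have nc: "n \<in> carrier R" using cl dc by (simp add: n_def)
  define z where "z = v \<otimes> (d \<otimes> (s \<otimes> f))"
  have zc: "z \<in> carrier R" using cl dc vc by (simp add: z_def)
  have fz: "f \<otimes> z = \<zero>"
    using cl dc vc by (simp add: z_def mult_absorb[OF fv] mult_absorb[OF d(3)])
  have zp: "z \<otimes> p = \<zero>" using cl dc vc p by (simp add: z_def m_assoc)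
  have pz: "p \<otimes> z = z"
  proof -
    have "(p \<oplus> f) \<otimes> z = p \<otimes> z" using cl zc fz by (simp add: l_distr)
    then show ?thesis using p(2) zc by simp
  qed
  have zz: "z \<otimes> z = \<zero>"
    using cl zc pz by (metis mult_absorb zp l_null)
  define e where "e = p \<oplus> z"
  have ec: "e \<in> carrier R" using cl zc by (simp add: e_def)
  have ee: "e \<otimes> e = e" using cl(2) zc p(5) pz zp zz by (simp add: e_def l_distr r_distr)
  have ep: "e \<otimes> p = p" using cl zc p zp by (simp add: e_def l_distr)
  have fe: "f \<otimes> e = \<zero>" using cl zc p fz by (simp add: e_def r_distr)
  \<comment> \<open>On \<open>dR\<close> the component \<open>p b\<close> vanishes, so \<open>f b\<close> alone has to be left invertible there.\<close>
  have pbd: "p \<otimes> (b \<otimes> d) = \<zero>"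
  proof -
    have "p \<otimes> (b \<otimes> d) = c \<otimes> d" using cl dc d(2) by (simp add: c_def m_assoc)
    then show ?thesis using d by simp
  qed
  have nd: "n \<otimes> d = d"
  proof -
    have "d = d \<otimes> ((r \<otimes> f \<oplus> s \<otimes> b) \<otimes> d)" if "d \<otimes> d = d" using rfsb dc that by simp
    moreover have "d \<otimes> d = d" using d(1,4) dq dc qc cl(2) by (metis l_distr r_zero d(2) m_closed)
    moreover have "(r \<otimes> f \<oplus> s \<otimes> b) \<otimes> d = s \<otimes> (b \<otimes> d)"
      using cl dc d(3) by (simp add: l_distr m_assoc)
    moreover have "b \<otimes> d = f \<otimes> (b \<otimes> d)"
    proof -
      have "(p \<oplus> f) \<otimes> (b \<otimes> d) = f \<otimes> (b \<otimes> d)"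
        using cl dc pbd by (simp add: l_distr)
      then show ?thesis using p(2) cl dc by simp
    qed
    ultimately have "d = d \<otimes> (s \<otimes> (f \<otimes> (b \<otimes> d)))" by simp
    then show ?thesis using cl dc by (simp add: n_def m_assoc)
  qed
  define N where "N = n \<otimes> q"
  have Nc: "N \<in> carrier R" using nc qc by (simp add: N_def)
  have qn: "q \<otimes> n = \<zero>" using qc dc cl d(4) by (simp add: n_def mult_absorb[OF d(4)])
  have NN: "N \<otimes> N = \<zero>" using nc qc by (simp add: N_def m_assoc mult_absorb[OF qn])
  have np: "n \<otimes> p = d \<oplus> N"
    unfolding dq[symmetric] N_def using nc dc qc nd by (simp add: r_distr)
  have diag: "f \<oplus> e \<otimes> (b \<otimes> p) = v \<otimes> (\<one> \<oplus> N)"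
  proof -
    have "\<one> \<oplus> N = f \<oplus> (q \<oplus> (d \<oplus> N))"
      unfolding p(2)[symmetric] dq[symmetric] using dc qc f Nc by (simp add: a_ac)
    then have "v \<otimes> (\<one> \<oplus> N) = f \<oplus> (c \<oplus> v \<otimes> (n \<otimes> p))"
      using vc f qc nc cl(2) vf vq by (simp add: np[symmetric] r_distr)
    moreover have "v \<otimes> (n \<otimes> p) = z \<otimes> (b \<otimes> p)" using vc dc cl by (simp add: n_def z_def m_assoc)
    moreover have "e \<otimes> (b \<otimes> p) = c \<oplus> z \<otimes> (b \<otimes> p)" using cl zc by (simp add: e_def c_def l_distr)
    ultimately show ?thesis by simp
  qed
  \<comment> \<open>The first factor is unipotent because \<open>f e = 0\<close>: the triangular shape of \<open>f + e b\<close>.\<close>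
  have lower: "f \<oplus> e \<otimes> b = (\<one> \<oplus> e \<otimes> (b \<otimes> f)) \<otimes> (f \<oplus> e \<otimes> (b \<otimes> p))"
  proof -
    have "e \<otimes> b = e \<otimes> (b \<otimes> (p \<oplus> f))" using p(2) cl by simp
    then have "e \<otimes> b = e \<otimes> (b \<otimes> p) \<oplus> e \<otimes> (b \<otimes> f)" using cl ec by (simp add: r_distr)
    then show ?thesis
      using cl ec f by (simp add: l_distr r_distr m_assoc mult_absorb[OF fe] a_ac)
  qed
  have "(e \<otimes> (b \<otimes> f)) \<otimes> (e \<otimes> (b \<otimes> f)) = \<zero>"
    using cl ec by (simp add: m_assoc mult_absorb[OF fe])
  then have "\<one> \<oplus> e \<otimes> (b \<otimes> f) \<in> Units R" using unit_one_plus_square_zero cl ec by simp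
  then have "f \<oplus> e \<otimes> b \<in> Units R"
    unfolding lower diag using unit_one_plus_square_zero[OF Nc NN] v(1) by simp
  with ec ee p(1,2) ep fe show ?thesis using that by blast
qed

text \<open>
  Left multiplication by the unit \<open>u\<close> turns \<open>a\<close> into the idempotent \<open>u a\<close>; an idempotent \<open>e\<close> found
  for \<open>u a\<close> and \<open>u b\<close> corresponds to \<open>u\<^sup>-\<^sup>1 e u\<close> for \<open>a\<close> and \<open>b\<close>.
\<close>

lemma IC_SSP_stable_range:
  assumes ic: "IC R" and ssp: "SSP R" and a: "vn_regular R a" and b: "vn_regular R b"
    and gen: "(carrier R #> a) <+> (carrier R #> b) = carrier R"
  shows "\<exists>e. idempotent_elem R e \<and> a \<oplus> e \<otimes> b \<in> Units R \<and>
             internal_direct_sum R (a <# carrier R) (e <# carrier R)"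
proof -
  have ac: "a \<in> carrier R" and bc: "b \<in> carrier R" using a b by (auto simp: vn_regular_def)
  have "unit_regular R a" using ic a ac by (auto simp: IC_def)
  then obtain u where u: "u \<in> Units R" "a \<otimes> u \<otimes> a = a" by (auto simp: unit_regular_def)
  define w where "w = inv u"
  have uw: "u \<in> carrier R" "w \<in> carrier R" "u \<otimes> w = \<one>" "w \<otimes> u = \<one>" "w \<in> Units R"
    using u by (simp_all add: w_def Units_closed)
  note wu = mult_absorb[OF uw(4) uw(2) uw(1)] and uw' = mult_absorb[OF uw(3) uw(1) uw(2)]
  obtain r s where rs: "r \<in> carrier R" "s \<in> carrier R" "r \<otimes> a \<oplus> s \<otimes> b = \<one>"
    using gen one_closed unfolding set_eq_iff mem_set_add mem_principal_left Bex_def by metis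
  define f where "f = u \<otimes> a"
  have fc: "f \<in> carrier R" using uw ac by (simp add: f_def)
  have ff: "f \<otimes> f = f" using u(2) uw ac by (simp add: f_def m_assoc)
  have wf: "w \<otimes> f = a" using uw ac by (simp add: f_def wu)
  have "vn_regular R u" using vn_regularI[of u w] uw by simp
  then have ub: "vn_regular R (u \<otimes> b)" using vn_regular_mult[OF ssp] b by blast
  have "(r \<otimes> w) \<otimes> f \<oplus> (s \<otimes> w) \<otimes> (u \<otimes> b) = \<one>"
    using rs uw ac bc fc by (simp add: m_assoc wf wu)
  then obtain e p where e: "e \<in> carrier R" "e \<otimes> e = e" "p \<in> carrier R" "p \<oplus> f = \<one>"
    "e \<otimes> p = p" "f \<otimes> e = \<zero>" "f \<oplus> e \<otimes> (u \<otimes> b) \<in> Units R"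
    using IC_SSP_idempotent_completion[OF ic ssp fc ff ub] rs uw by (metis m_closed)
  define g where "g = w \<otimes> (e \<otimes> u)"
  have gc: "g \<in> carrier R" using e uw by (simp add: g_def)
  have "g \<otimes> g = g"
    using e(1) uw by (simp add: g_def m_assoc uw' mult_absorb[OF e(2)])
  moreover have "a \<oplus> g \<otimes> b = w \<otimes> (f \<oplus> e \<otimes> (u \<otimes> b))"
    using e(1) uw bc fc by (simp add: g_def r_distr m_assoc wf)
  then have "a \<oplus> g \<otimes> b \<in> Units R" using e(7) uw by simp
  moreover have "internal_direct_sum R (a <# carrier R) (g <# carrier R)"
  proof (rule principal_internal_direct_sumI[OF ac gc, of u "w \<otimes> (p \<otimes> u)"])
    have "a \<otimes> u \<oplus> g \<otimes> (w \<otimes> (p \<otimes> u)) = w \<otimes> ((p \<oplus> f) \<otimes> u)"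
      using e(1,3) uw fc
      by (simp add: g_def l_distr r_distr m_assoc uw' mult_absorb[OF e(5)] wf[symmetric] a_comm)
    then show "a \<otimes> u \<oplus> g \<otimes> (w \<otimes> (p \<otimes> u)) = \<one>" using e(4) uw by simp
  next
    fix x y assume xy: "x \<in> carrier R" "y \<in> carrier R" "a \<otimes> x = g \<otimes> y"
    have "f \<otimes> x = f \<otimes> (u \<otimes> (a \<otimes> x))"
      using xy(1) fc ff uw ac by (metis f_def m_assoc m_closed)
    also have "\<dots> = \<zero>"
      unfolding xy(3) using xy(2) e(1) uw fc
      by (simp add: g_def m_assoc uw' mult_absorb[OF e(6)])
    finally have "f \<otimes> x = \<zero>" .
    moreover have "a \<otimes> x = w \<otimes> (f \<otimes> x)" using wf uw fc xy(1) by (metis m_assoc)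
    ultimately show "a \<otimes> x = \<zero>" using uw by simp
  qed (use e uw in auto)
  ultimately show ?thesis using gc by (auto simp: idempotent_elem_def)
qed

section \<open>Special cleanness\<close>

text \<open>
  Since \<open>-1\<close> is a unit, the stable range condition applies to the pair \<open>a, -1\<close> and yields a unit
  \<open>a - e\<close>.
\<close>

lemma special_clean_of_stable_range:
  assumes a: "vn_regular R a"
    and stable: "\<And>b. \<lbrakk>vn_regular R b; (carrier R #> a) <+> (carrier R #> b) = carrier R\<rbrakk> \<Longrightarrow>
      \<exists>e. idempotent_elem R e \<and> a \<oplus> e \<otimes> b \<in> Units R \<and>
          internal_direct_sum R (a <# carrier R) (e <# carrier R)"
  shows "special_clean R a"
proof -
  have ac: "a \<in> carrier R" using a by (simp add: vn_regular_def)
  have reg: "vn_regular R (\<ominus> \<one>)"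
    using vn_regularI[of "\<ominus> \<one>" "\<ominus> \<one>"] by (simp add: l_minus)
  have "t \<in> (carrier R #> a) <+> (carrier R #> (\<ominus> \<one>))" if t: "t \<in> carrier R" for t :: 'a
  proof -
    have "t = \<zero> \<otimes> a \<oplus> (\<ominus> t) \<otimes> (\<ominus> \<one>)" using t ac by (simp add: l_minus r_minus)
    then show ?thesis using t by (metis a_inv_closed mem_principal_left_add zero_closed)
  qed
  moreover have "(carrier R #> a) <+> (carrier R #> (\<ominus> \<one>)) \<subseteq> carrier R"
    using ac by (auto simp: mem_set_add mem_principal_left)
  ultimately have "(carrier R #> a) <+> (carrier R #> (\<ominus> \<one>)) = carrier R" by blast
  then obtain e where e: "idempotent_elem R e" "a \<oplus> e \<otimes> (\<ominus> \<one>) \<in> Units R"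
    "internal_direct_sum R (a <# carrier R) (e <# carrier R)"
    using stable[OF reg] by blast
  have ec: "e \<in> carrier R" using e(1) by (simp add: idempotent_elem_def)
  have "a = e \<oplus> (a \<oplus> e \<otimes> (\<ominus> \<one>))" using ac ec by (simp add: r_minus a_lcomm[of e a] r_neg)
  then show ?thesis using e ac unfolding special_clean_def internal_direct_sum_def by blast
qed

lemma unit_regular_of_special_clean:
  assumes "special_clean R a"
  shows "unit_regular R a"
proof -
  obtain e u where a: "a \<in> carrier R" and e: "e \<in> carrier R" "e \<otimes> e = e"
    and u: "u \<in> Units R" and eu: "a = e \<oplus> u"
    and disj: "(a <# carrier R) \<inter> (e <# carrier R) = {\<zero>}"
    using assms by (auto simp: special_clean_def idempotent_elem_def)
  define w where "w = inv u"
  have w: "w \<in> Units R" "w \<in> carrier R" "u \<in> carrier R" "u \<otimes> w = \<one>" "w \<otimes> u = \<one>"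
    using u by (simp_all add: w_def Units_closed)
  \<comment> \<open>Both sides are \<open>a w a - a\<close>, written once as an element of \<open>aR\<close> and once of \<open>eR\<close>.\<close>
  have "a \<otimes> (w \<otimes> e) = e \<otimes> (w \<otimes> e \<oplus> \<one>)"
    using e(1) w by (simp add: eu l_distr r_distr mult_absorb[OF w(4)])
  then have "a \<otimes> (w \<otimes> e) \<in> (a <# carrier R) \<inter> (e <# carrier R)"
    unfolding Int_iff mem_principal_right using e(1) w(2) by blast
  then have zero: "a \<otimes> (w \<otimes> e) = \<zero>" using disj by blast
  have "a \<otimes> w \<otimes> a = a \<otimes> (w \<otimes> e) \<oplus> a \<otimes> (w \<otimes> u)"
    using a e(1) w(2,3) by (subst (2) eu) (simp add: m_assoc r_distr)
  then have "a \<otimes> w \<otimes> a = a" using zero w a by simp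
  then show ?thesis unfolding unit_regular_def using a w(1) by metis
qed

end

theorem theorem2p4:
  fixes R :: "('a, 'm) ring_scheme" (structure)
  assumes "ring R" and "SSP R"
  shows "(IC R \<longleftrightarrow>
           (\<forall>a b. vn_regular R a \<longrightarrow> vn_regular R b \<longrightarrow>
              (carrier R #> a) <+> (carrier R #> b) = carrier R \<longrightarrow>
              (\<exists>e. idempotent_elem R e \<and> a \<oplus> e \<otimes> b \<in> Units R \<and>
                   internal_direct_sum R (a <# carrier R) (e <# carrier R)))) \<and>
         (IC R \<longleftrightarrow> (\<forall>a. vn_regular R a \<longrightarrow> special_clean R a))"
    (is "(_ \<longleftrightarrow> ?stable) \<and> (_ \<longleftrightarrow> ?clean)")
proof -
  interpret ring R by fact
  have "IC R \<Longrightarrow> ?stable" using IC_SSP_stable_range \<open>SSP R\<close> by blast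
  moreover have "?stable \<Longrightarrow> ?clean" using special_clean_of_stable_range by blast
  moreover have "?clean \<Longrightarrow> IC R" using unit_regular_of_special_clean by (auto simp: IC_def)
  ultimately show ?thesis by blast
qed

end
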